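(* Let $G$ be a digraph with adjacency matrix $A_G$ and assume that the numerical range $W(A_G)$ is contained in a disk of radius $r$ centered at $c$. Further, let $E_{ij}=\mathbf e_i\mathbf e_j^T\in\mathbb{R}^{n\times n}$ and denote $m(u,v):=d(u,i)+d(j,v)$. Then $$|[L_{\exp}(A_G,E_{ij})]_{uv}| \le 2\left(1+\sqrt2\right)^2 e^{r+c}\,\frac{\gamma(m(u,v),r)}{(m(u,v)-1)!},$$ where $\gamma(a,x)=\int_0^x t^{a-1}e^{-t}\,dt$ is the lower incomplete gamma function.
   Context: A (possibly weighted) digraph $G$ has node set $\mathcal V=\{1,\dots,n\}$, edge set $\mathcal E\subseteq \mathcal V\times\mathcal V$ (no self loops, no multiple edges with the same direction) and weights $w_{ij}>0$ for $(i,j)\in\mathcal E$ (all equal to $1$ if unweighted); its adjacency matrix $A_G\in\mathbb{R}^{n\times n}$ has entries $a_{ij}=w_{ij}$ if $(i,j)\in\mathcal E$ and $0$ otherwise. $i,j,u,v$ are nodes of $G$. $d(u,v)$ is the geodesic distance in $G$: the smallest number of edges on any path connecting node $u$ to node $v$. The numerical range is $W(A_G)=\{\mathbf x^*A_G\mathbf x : \mathbf x\in\mathbb{C}^n,\ \|\mathbf x\|=1\}\subset\mathbb{C}$, with $\|\cdot\|$ the Euclidean norm. $\mathbf e_i$ is the $i$th canonical unit vector of $\mathbb{R}^n$, and $[M]_{uv}$ is the $(u,v)$ entry of a matrix $M$. $L_{\exp}(A,\cdot)$ is the Fréchet derivative of the matrix exponential at $A$: the linear operator satisfying $\exp(A+E)-\exp(A)=L_{\exp}(A,E)+o(\|E\|)$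 for all $E\in\mathbb{R}^{n\times n}$. *)

theory Defs
  imports "HOL-Analysis.Analysis"
begin

text \<open>
  The nodes are the elements of a finite type \<open>'n\<close>, playing the role of \<open>{1,\<dots>,n}\<close>.
  Edges form a set of pairs, so parallel edges with the same direction cannot occur.
  Weights outside the edge set are irrelevant; an unweighted digraph has all weights 1.
\<close>

record 'n wdigraph =
  edges :: "('n \<times> 'n) set"
  weight :: "'n \<Rightarrow> 'n \<Rightarrow> real"

definition is_digraph :: "'n wdigraph \<Rightarrow> bool" where
  "is_digraph G \<longleftrightarrow>
     (\<forall>k. (k, k) \<notin> edges G) \<and> (\<forall>(k, l) \<in> edges G. weight G k l > 0)"

definition adjacency :: "('n::finite) wdigraph \<Rightarrow> real^'n^'n" where
  "adjacency G = (\<chi> k l. if (k, l) \<in> edges G then weight G k l else 0)"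

text \<open>A path is given by the list of its nodes, so it has \<open>length p - 1\<close> edges.\<close>

definition is_path :: "'n wdigraph \<Rightarrow> 'n \<Rightarrow> 'n list \<Rightarrow> 'n \<Rightarrow> bool" where
  "is_path G u p v \<longleftrightarrow>
     p \<noteq> [] \<and> hd p = u \<and> last p = v \<and> distinct p \<and>
     successively (\<lambda>x y. (x, y) \<in> edges G) p"

text \<open>The distance is \<open>\<infinity>\<close> (the infimum of the empty set) if there is no path.\<close>

definition geodesic_dist :: "'n wdigraph \<Rightarrow> 'n \<Rightarrow> 'n \<Rightarrow> enat" where
  "geodesic_dist G u v = (INF p \<in> {p. is_path G u p v}. enat (length p - 1))"

definition numerical_range :: "complex^'n^'n \<Rightarrow> complex set" where
  "numerical_range M = {(\<Sum>k\<in>UNIV. cnj (x $ k) * (M *v x) $ k) | x. norm x = 1}"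

text \<open>
  The product \<open>*\<close> on \<open>real^'n^'n\<close> is componentwise, so the library's power and \<open>exp\<close>
  do not give matrix powers and the matrix exponential.
\<close>

primrec mat_pow :: "real^'n^'n \<Rightarrow> nat \<Rightarrow> real^'n^'n" where
  "mat_pow A 0 = mat 1"
| "mat_pow A (Suc k) = A ** mat_pow A k"

definition mat_exp :: "real^'n^'n \<Rightarrow> real^'n^'n" where
  "mat_exp A = (\<Sum>k. (1 / fact k) *\<^sub>R mat_pow A k)"

text \<open>
  The norm on \<open>real^'n^'n\<close> is the Frobenius norm; since all norms on this space are
  equivalent, the Frechet derivative does not depend on this choice.
\<close>

definition L_exp :: "real^'n^'n \<Rightarrow> real^'n^'n \<Rightarrow> real^'n^'n" where
  "L_exp A = frechet_derivative mat_exp (at A)"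

text \<open>The inner dimension 1 of the product has to be fixed by a type constraint.\<close>

definition unit_matrix :: "'n \<Rightarrow> 'n \<Rightarrow> real^'n^'n" where
  "unit_matrix i j = (columnvector (axis i 1) :: real^1^'n) ** rowvector (axis j 1)"

definition lower_incomplete_gamma :: "real \<Rightarrow> real \<Rightarrow> real" where
  "lower_incomplete_gamma a x = integral {0..x} (\<lambda>t. t powr (a - 1) * exp (- t))"

end

theory Submission
  imports Defs
begin

text \<open>
  Put \<open>B = A - Re c \<cdot> I\<close>. Since \<open>exp A = exp (Re c) \<cdot> exp B\<close>, termwise differentiation of the exponential
  series gives the entry \<open>(u, v)\<close> of the derivative as \<open>exp (Re c)\<close> times the sum over \<open>a, b\<close> of
  \<open>(B\<^sup>a)\<^sub>u\<^sub>i (B\<^sup>b)\<^sub>j\<^sub>v / (a + b + 1)!\<close>. A summand vanishes unless \<open>a \<ge> d(u,i)\<close> and \<open>b \<ge> d(j,v)\<close>, so only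
  \<open>a + b \<ge> m(u,v)\<close> contributes. The numerical radius of \<open>B\<close> is at most \<open>r\<close>, hence Berger's power
  inequality and polarization bound the entries of \<open>B\<^sup>l\<close> by \<open>2 r\<^sup>l\<close>; this replaces the
  Crouzeix-Palencia theorem and gives the better constant 4. What remains is the tail of the
  exponential series of \<open>r\<close> from index \<open>m(u,v)\<close> on, an incomplete gamma function.
\<close>

section \<open>Powers of a matrix with bounded numerical radius\<close>

text \<open>Conjugate-linear in the first argument, so that \<open>hinner x (M *v x)\<close> is
  literally the expression whose values form \<open>numerical_range M\<close>.\<close>

definition hinner :: "complex^'n \<Rightarrow> complex^'n \<Rightarrow> complex" where
  "hinner x y = (\<Sum>k\<in>UNIV. cnj (x $ k) * y $ k)"

lemma hinner_add_left: "hinner (x + y) z = hinner x z + hinner y z"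
  by (simp add: hinner_def algebra_simps sum.distrib)

lemma hinner_add_right: "hinner x (y + z) = hinner x y + hinner x z"
  by (simp add: hinner_def algebra_simps sum.distrib)

lemma hinner_diff_right: "hinner x (y - z) = hinner x y - hinner x z"
  by (simp add: hinner_def algebra_simps sum_subtractf)

lemma hinner_scale_left: "hinner (a *s x) y = cnj a * hinner x y"
  by (simp add: hinner_def algebra_simps sum_distrib_left)

lemma hinner_scale_right: "hinner x (a *s y) = a * hinner x y"
  by (simp add: hinner_def algebra_simps sum_distrib_left)

lemma hinner_sum_left: "hinner (\<Sum>j\<in>J. x j) y = (\<Sum>j\<in>J. hinner (x j) y)"
  by (induction J rule: infinite_finite_induct) (simp_all add: hinner_add_left, simp_all add: hinner_def)

lemma hinner_self: "hinner x x = of_real ((norm x)\<^sup>2)"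
proof -
  have "(norm x)\<^sup>2 = (\<Sum>k\<in>UNIV. (cmod (x $ k))\<^sup>2)"
    by (simp add: norm_vec_def L2_set_def sum_nonneg)
  then show ?thesis
    by (simp only: hinner_def of_real_sum complex_norm_square mult.commute)
qed

lemma hinner_axis: "hinner (axis k 1) y = y $ k"
proof -
  have "hinner (axis k 1) y = (\<Sum>l\<in>UNIV. if l = k then y $ l else 0)"
    unfolding hinner_def by (intro sum.cong) (auto simp: axis_def)
  then show ?thesis by simp
qed

section \<open>Berger's power inequality\<close>

lemma matrix_vector_mult_scale: "M *v (a *s x) = a *s (M *v x)" for M :: "complex^'n^'m"
  by (simp add: vector_scalar_commute)

text \<open>Up to the factor \<open>\<eta> ^ k\<close> this is a geometric sum with ratio
  \<open>w\<close>, where \<open>w ^ N = 1\<close> and \<open>w\<close> differs from 1 because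
  \<open>N\<close> does not divide \<open>k\<close>.\<close>

lemma sum_powers_of_rotated_roots:
  assumes "0 < k" "k < N"
  shows "(\<Sum>j<N. (\<eta> * cis (2 * pi * real j / real N)) ^ k) = 0"
proof -
  define w where "w = cis (2 * pi * real k / real N)"
  have "w = exp (2 * of_real pi * \<i> * of_nat k / of_nat N)"
    by (simp add: w_def cis_conv_exp field_simps)
  then have "w \<noteq> 1"
    using assms complex_root_unity_eq_1[of N k] by (auto dest: nat_dvd_not_less)
  moreover have "w ^ N = 1"
    using assms by (simp add: w_def Complex.DeMoivre cis_multiple_2pi)
  ultimately have "(\<Sum>j<N. w ^ j) = 0"
    by (simp add: geometric_sum)
  moreover have "(\<eta> * cis (2 * pi * real j / real N)) ^ k = \<eta> ^ k * w ^ j" for j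
    by (simp add: power_mult_distrib w_def Complex.DeMoivre mult_ac)
  ultimately show ?thesis
    by (simp add: sum_distrib_left[symmetric])
qed

text \<open>The factorization of \<open>1 - (q M)^N\<close> by \<open>1 - q M\<close>, applied to
  \<open>x\<close>; it is finite, so no convergence is involved.\<close>

lemma geometric_telescope:
  fixes M :: "complex^'n^'n" and x :: "complex^'n"
  defines "P \<equiv> \<lambda>k. ((*v) M ^^ k) x"
  shows "(\<Sum>k<N. q ^ k *s P k) - q *s (M *v (\<Sum>k<N. q ^ k *s P k)) = x - q ^ N *s P N"
proof (induction N)
  case 0
  show ?case by (simp add: P_def vec_eq_iff)
next
  case (Suc N)
  have "P (Suc N) = M *v P N" by (simp add: P_def)
  with Suc show ?case
    by (simp add: matrix_vector_right_distrib matrix_vector_mult_scale vec_eq_iff algebra_simps)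
qed

text \<open>Pearcy's argument: with \<open>\<zeta>\<close> running through the \<open>N\<close>-th roots of \<open>\<mu>\<close>, the vectors
  \<open>z \<zeta> = (\<Sum>k<N. (\<zeta>/r)^k M^k x)\<close> add up to \<open>N x\<close>, while \<open>(1 - (\<zeta>/r) M) (z \<zeta>) = (1 - \<mu> (M/r)^N) x\<close>
  does not depend on \<open>\<zeta>\<close>.\<close>

lemma berger_rotated:
  fixes M :: "complex^'n^'n"
  assumes r: "r > 0" and W: "\<And>y. cmod (hinner y (M *v y)) \<le> r * (norm y)\<^sup>2"
    and \<mu>: "cmod \<mu> = 1" and N: "N > 0"
  shows "Re (\<mu> * hinner x (((*v) M ^^ N) x)) \<le> r ^ N * (norm x)\<^sup>2"
proof -
  define \<eta> where "\<eta> = cis (Arg \<mu> / real N)"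
  have \<eta>: "\<eta> ^ N = \<mu>" "cmod \<eta> = 1"
    using N \<mu> by (auto simp: \<eta>_def Complex.DeMoivre cis_Arg_unique)
      (metis Complex.sgn_eq cis_Arg div_by_1 of_real_1 norm_zero zero_neq_one)
  define \<zeta> where "\<zeta> j = \<eta> * cis (2 * pi * real j / real N)" for j
  have \<zeta>: "\<zeta> j ^ N = \<mu>" "cmod (\<zeta> j) = 1" for j
    using N \<eta> by (simp_all add: \<zeta>_def power_mult_distrib Complex.DeMoivre cis_multiple_2pi norm_mult)
  define P where "P k = ((*v) M ^^ k) x" for k
  define z where "z j = (\<Sum>k<N. (\<zeta> j / r) ^ k *s P k)" for j
  define y where "y = x - (\<mu> / r ^ N) *s P N"
  have z_eq: "z j - (\<zeta> j / r) *s (M *v z j) = y" for j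
    using geometric_telescope[where M = M and x = x and q = "\<zeta> j / r" and N = N]
    by (simp add: z_def P_def y_def power_divide \<zeta>)
  \<comment> \<open>Interchanging the sums leaves power sums of the roots. They vanish for
    \<open>0 < k < N\<close>, so only the \<open>k = 0\<close> vector \<open>x\<close> survives,
    \<open>N\<close> times.\<close>
  have "(\<Sum>j<N. z j) = (\<Sum>k<N. \<Sum>j<N. (\<zeta> j / r) ^ k *s P k)"
    unfolding z_def by (rule sum.swap)
  also have "\<dots> = (\<Sum>k<N. if k = 0 then of_nat N *s x else 0)"
  proof (intro sum.cong refl)
    fix k assume k: "k \<in> {..<N}"
    have "(\<Sum>j<N. (\<zeta> j / r) ^ k *s P k) = (\<Sum>j<N. (\<zeta> j / r) ^ k) *s P k"
      by (simp add: vec_eq_iff sum_distrib_right)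
    also have "(\<Sum>j<N. (\<zeta> j / r) ^ k) = (\<Sum>j<N. \<zeta> j ^ k) / r ^ k"
      by (simp add: power_divide sum_divide_distrib)
    also have "\<dots> *s P k = (if k = 0 then of_nat N *s x else 0)"
      using k sum_powers_of_rotated_roots[of k N \<eta>]
      by (auto simp: \<zeta>_def P_def)
    finally show "(\<Sum>j<N. (\<zeta> j / r) ^ k *s P k) = (if k = 0 then of_nat N *s x else 0)" .
  qed
  finally have sum_z: "(\<Sum>j<N. z j) = of_nat N *s x"
    using N by simp
  \<comment> \<open>With \<open>z_eq\<close> substituted for \<open>y\<close>, this is the numerical
    radius bound at \<open>z j\<close>, since \<open>\<zeta> j\<close> has modulus 1. As
    \<open>y\<close> is the same for all \<open>j\<close>, the inequalities can be added.\<close>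
  have "Re (hinner (z j) y) \<ge> 0" for j
  proof -
    have "cmod (\<zeta> j / r * hinner (z j) (M *v z j)) \<le> (norm (z j))\<^sup>2"
      using W[of "z j"] r by (simp add: norm_mult norm_divide \<zeta> field_simps)
    then have "Re (\<zeta> j / r * hinner (z j) (M *v z j)) \<le> (norm (z j))\<^sup>2"
      using complex_Re_le_cmod order_trans by blast
    then show ?thesis
      by (simp add: z_eq[of j, symmetric] hinner_diff_right hinner_scale_right hinner_self
          del: Re_divide_of_real)
  qed
  then have "0 \<le> (\<Sum>j<N. Re (hinner (z j) y))"
    by (simp add: sum_nonneg)
  also have "\<dots> = Re (hinner (of_nat N *s x) y)"
    by (simp add: sum_z[symmetric] hinner_sum_left)
  also have "\<dots> = real N * Re (hinner x y)"
    by (simp add: hinner_scale_left)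
  finally have "0 \<le> Re (hinner x y)"
    using N by (simp add: zero_le_mult_iff)
  also have "hinner x y = of_real ((norm x)\<^sup>2) - \<mu> * hinner x (P N) / of_real (r ^ N)"
    by (simp add: y_def hinner_diff_right hinner_scale_right hinner_self)
  also have "Re \<dots> = (norm x)\<^sup>2 - Re (\<mu> * hinner x (P N)) / r ^ N"
    by (simp only: minus_complex.sel Re_complex_of_real Re_divide_of_real)
  finally show ?thesis
    using r by (simp add: P_def field_simps)
qed

text \<open>The free phase \<open>\<mu>\<close> of the rotated version is chosen to turn the real
  part into the modulus.\<close>

lemma berger_power_inequality:
  fixes M :: "complex^'n^'n"
  assumes r: "r > 0" and W: "\<And>y. cmod (hinner y (M *v y)) \<le> r * (norm y)\<^sup>2"
  shows "cmod (hinner x (((*v) M ^^ N) x)) \<le> r ^ N * (norm x)\<^sup>2"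
proof (cases "N = 0")
  case True
  then show ?thesis by (simp add: hinner_self del: of_real_power)
next
  case False
  define a where "a = hinner x (((*v) M ^^ N) x)"
  have "cmod (cis (- Arg a)) = 1" by simp
  from berger_rotated[OF r W this, of N x] False
  have "Re (cis (- Arg a) * a) \<le> r ^ N * (norm x)\<^sup>2" by (simp add: a_def)
  also have "cis (- Arg a) * a = cis (- Arg a) * rcis (cmod a) (Arg a)"
    by (simp add: rcis_cmod_Arg)
  also have "\<dots> = of_real (cmod a)"
    by (simp add: rcis_def cis_mult mult.left_commute)
  finally show ?thesis by (simp add: a_def)
qed

text \<open>Polarization over the fourth roots of unity recovers the sesquilinear form from its
  quadratic form; the four squared norms add up by the parallelogram law.\<close>

lemma hinner_polarization:
  fixes T :: "complex^'n \<Rightarrow> complex^'n"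
  assumes add: "\<And>x y. T (x + y) = T x + T y" and scale: "\<And>a x. T (a *s x) = a *s T x"
    and w: "\<And>x. cmod (hinner x (T x)) \<le> w * (norm x)\<^sup>2"
  shows "cmod (hinner x (T y)) \<le> w * ((norm x)\<^sup>2 + (norm y)\<^sup>2)"
proof -
  define Q where "Q a = hinner (x + a *s y) (T (x + a *s y))" for a
  define n2 where "n2 a = (norm (x + a *s y))\<^sup>2" for a
  have Q: "cmod (Q a) \<le> w * n2 a" for a
    unfolding Q_def n2_def by (rule w)
  have Q_expand: "Q a = hinner x (T x) + a * hinner x (T y) + cnj a * hinner y (T x)
      + a * cnj a * hinner y (T y)" for a
    by (simp add: Q_def add scale hinner_add_left hinner_add_right hinner_scale_left
        hinner_scale_right algebra_simps)
  have n2_expand: "of_real (n2 a) = hinner x x + a * hinner x y + cnj a * hinner y x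
      + a * cnj a * hinner y y" for a
    unfolding n2_def hinner_self[symmetric]
    by (simp add: hinner_add_left hinner_add_right hinner_scale_left
        hinner_scale_right algebra_simps)
  have pol: "4 * hinner x (T y) = Q 1 - Q (-1) - \<i> * Q \<i> + \<i> * Q (-\<i>)"
    by (simp add: Q_expand algebra_simps)
  have "complex_of_real (n2 1 + n2 (-1) + n2 \<i> + n2 (-\<i>))
      = 4 * (hinner x x + hinner y y)"
    by (simp add: n2_expand algebra_simps)
  also have "\<dots> = of_real (4 * ((norm x)\<^sup>2 + (norm y)\<^sup>2))"
    by (simp add: hinner_self)
  finally have n2: "n2 1 + n2 (-1) + n2 \<i> + n2 (-\<i>) = 4 * ((norm x)\<^sup>2 + (norm y)\<^sup>2)"
    by (simp only: of_real_eq_iff)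
  have "4 * cmod (hinner x (T y)) = cmod (Q 1 - Q (-1) - \<i> * Q \<i> + \<i> * Q (-\<i>))"
    by (simp add: pol[symmetric] norm_mult)
  also have "\<dots> \<le> cmod (Q 1) + cmod (Q (-1)) + cmod (Q \<i>) + cmod (Q (-\<i>))"
  proof -
    have "cmod (Q 1 - Q (-1) - \<i> * Q \<i> + \<i> * Q (-\<i>))
        \<le> cmod (Q 1) + cmod (Q (-1)) + cmod (\<i> * Q \<i>) + cmod (\<i> * Q (-\<i>))"
      by (intro norm_triangle_le norm_triangle_le_diff add_mono order_refl)
    then show ?thesis by (simp add: norm_mult)
  qed
  also have "\<dots> \<le> w * (n2 1 + n2 (-1) + n2 \<i> + n2 (-\<i>))"
    using Q[of 1] Q[of "-1"] Q[of \<i>] Q[of "-\<i>"] by (simp add: distrib_left)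
  finally show ?thesis
    unfolding n2 by (simp add: algebra_simps)
qed

section \<open>Entries of powers of a real matrix\<close>

lemma matrix_iterate_add:
  "((*v) M ^^ k) (x + y) = ((*v) M ^^ k) x + ((*v) M ^^ k) y" for M :: "complex^'n^'n"
  by (induction k) (simp_all add: matrix_vector_right_distrib)

lemma matrix_iterate_scale:
  "((*v) M ^^ k) (a *s x) = a *s ((*v) M ^^ k) x" for M :: "complex^'n^'n"
  by (induction k) (simp_all add: matrix_vector_mult_scale)

lemma mat_pow_complex_iterate:
  fixes B :: "real^'n^'n"
  shows "((*v) (map_matrix complex_of_real B) ^^ k) (axis v 1) $ u = of_real (mat_pow B k $ u $ v)"
proof (induction k arbitrary: u)
  case 0
  show ?case by (simp add: mat_def axis_def)
next
  case (Suc k)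
  have "(map_matrix complex_of_real B *v y) $ u = (\<Sum>w\<in>UNIV. of_real (B $ u $ w) * y $ w)" for y
    by (simp add: matrix_vector_mult_def)
  then show ?case
    by (simp add: matrix_matrix_mult_def Suc)
qed

text \<open>Polarization is applied to the \<open>k\<close>-th iterate, which obeys Berger's bound
  \<open>r ^ k\<close>; the factor 2 is the sum of the squared norms of two unit vectors.\<close>

lemma mat_pow_entry_bound_pos:
  fixes B :: "real^'n^'n"
  assumes "r > 0"
    and "\<And>y. cmod (hinner y (map_matrix complex_of_real B *v y)) \<le> r * (norm y)\<^sup>2"
  shows "\<bar>mat_pow B k $ u $ v\<bar> \<le> 2 * r ^ k"
proof -
  let ?T = "(*v) (map_matrix complex_of_real B) ^^ k"
  have "cmod (hinner (axis u 1) (?T (axis v 1)))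
      \<le> r ^ k * ((norm (axis u 1 :: complex^'n))\<^sup>2 + (norm (axis v 1 :: complex^'n))\<^sup>2)"
    by (intro hinner_polarization matrix_iterate_add matrix_iterate_scale
        berger_power_inequality assms)
  then show ?thesis
    by (simp add: hinner_axis mat_pow_complex_iterate)
qed

text \<open>The argument for Berger's inequality divides by \<open>r\<close>. The case
  \<open>r = 0\<close> is reached as a limit of radii \<open>s\<close> decreasing to
  \<open>r\<close>.\<close>

lemma mat_pow_entry_bound:
  fixes B :: "real^'n^'n"
  assumes "r \<ge> 0"
    and W: "\<And>y. cmod (hinner y (map_matrix complex_of_real B *v y)) \<le> r * (norm y)\<^sup>2"
  shows "\<bar>mat_pow B k $ u $ v\<bar> \<le> 2 * r ^ k"
proof (rule tendsto_lowerbound)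
  show "((\<lambda>s. 2 * s ^ k) \<longlongrightarrow> 2 * r ^ k) (at_right r)"
    by (intro tendsto_intros)
  show "eventually (\<lambda>s. \<bar>mat_pow B k $ u $ v\<bar> \<le> 2 * s ^ k) (at_right r)"
    unfolding eventually_at_filter
  proof (intro always_eventually allI impI)
    fix s assume "s \<in> {r<..}"
    with \<open>r \<ge> 0\<close> show "\<bar>mat_pow B k $ u $ v\<bar> \<le> 2 * s ^ k"
      by (intro mat_pow_entry_bound_pos order_trans[OF W] mult_right_mono) auto
  qed
qed auto

section \<open>The derivative of the matrix exponential\<close>

lemma bounded_bilinear_matrix_mult:
  "bounded_bilinear ((**) :: real^'n^'m \<Rightarrow> real^'p^'n \<Rightarrow> real^'p^'m)"
proof -
  have "linear (\<lambda>Y :: real^'p^'n. X ** Y)" for X :: "real^'n^'m"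
    by (rule linearI) (simp_all add: matrix_add_ldistrib matrix_matrix_mult_def vec_eq_iff
        sum_distrib_left mult_ac distrib_left sum.distrib)
  moreover have "linear (\<lambda>X :: real^'n^'m. X ** Y)" for Y :: "real^'p^'n"
    by (rule linearI) (simp_all add: matrix_matrix_mult_def vec_eq_iff
        sum_distrib_left mult_ac distrib_left sum.distrib)
  ultimately have "bilinear ((**) :: real^'n^'m \<Rightarrow> real^'p^'n \<Rightarrow> real^'p^'m)"
    unfolding bilinear_def by blast
  then show ?thesis
    by (simp add: bilinear_conv_bounded_bilinear)
qed

text \<open>Boundedness of the bilinear product gives a constant \<open>K\<close> that stands in for
  submultiplicativity; \<open>I\<close> is the norm of the identity matrix, which need not be
  1.\<close>

lemma mat_pow_norm_bound:
  obtains I K where "I \<ge> 0" "K > 0"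
    and "\<And>(X :: real^'n^'n) (Y :: real^'n^'n). norm (X ** Y) \<le> norm X * norm Y * K"
    and "\<And>(X :: real^'n^'n) k. norm (mat_pow X k) \<le> I * (norm X * K) ^ k"
proof -
  obtain K where K: "K > 0" "\<And>(X :: real^'n^'n) (Y :: real^'n^'n). norm (X ** Y) \<le> norm X * norm Y * K"
    using bounded_bilinear.pos_bounded[OF bounded_bilinear_matrix_mult] by blast
  define I where "I = norm (mat 1 :: real^'n^'n)"
  have "norm (mat_pow X k) \<le> I * (norm X * K) ^ k" for X :: "real^'n^'n" and k
  proof (induction k)
    case 0
    show ?case by (simp add: I_def)
  next
    case (Suc k)
    have "norm (X ** mat_pow X k) \<le> norm X * norm (mat_pow X k) * K" by (rule K(2))
    also have "\<dots> \<le> norm X * (I * (norm X * K) ^ k) * K"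
      using K(1) Suc by (intro mult_right_mono mult_left_mono) auto
    finally show ?case by (simp add: mult_ac)
  qed
  with K show thesis
    by (intro that[of I K]) (auto simp: I_def)
qed

lemma summable_norm_mat_exp: "summable (\<lambda>k. norm ((1 / fact k) *\<^sub>R mat_pow X k))"
  for X :: "real^'n^'n"
proof -
  obtain I K where "I \<ge> 0" "K > 0"
    and "\<And>(X :: real^'n^'n) (Y :: real^'n^'n). norm (X ** Y) \<le> norm X * norm Y * K"
    and "\<And>(X :: real^'n^'n) k. norm (mat_pow X k) \<le> I * (norm X * K) ^ k"
    by (rule mat_pow_norm_bound) (rule that)
  then have "norm ((1 / fact k) *\<^sub>R mat_pow X k) \<le> I * (inverse (fact k) * (norm X * K) ^ k)" for k
    by (simp add: divide_simps mult.commute)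
  moreover have "summable (\<lambda>k. I * (inverse (fact k) * (norm X * K) ^ k))"
    by (rule summable_mult[OF summable_exp])
  ultimately show ?thesis
    by (rule summable_norm_comparison_test[OF exI[of _ 0, OF allI[OF impI]]])
qed

lemma mat_exp_sums: "(\<lambda>k. (1 / fact k) *\<^sub>R mat_pow X k) sums mat_exp X"
  unfolding mat_exp_def by (intro summable_sums summable_norm_cancel[OF summable_norm_mat_exp])

text \<open>The product rule without commutativity: \<open>H\<close> replaces each of the
  \<open>k\<close> factors \<open>X\<close> in turn. At \<open>k = 0\<close> the truncated
  subtraction is harmless, as the sum is empty.\<close>

definition mat_pow_deriv :: "nat \<Rightarrow> real^'n^'n \<Rightarrow> real^'n^'n \<Rightarrow> real^'n^'n" where
  "mat_pow_deriv k X H = (\<Sum>a<k. mat_pow X a ** H ** mat_pow X (k - 1 - a))"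

lemma mat_pow_deriv_Suc:
  "mat_pow_deriv (Suc k) X H = H ** mat_pow X k + X ** mat_pow_deriv k X H"
proof -
  interpret bounded_bilinear "(**) :: real^'n^'n \<Rightarrow> real^'n^'n \<Rightarrow> real^'n^'n"
    by (rule bounded_bilinear_matrix_mult)
  show ?thesis
    by (simp add: mat_pow_deriv_def sum.lessThan_Suc_shift sum_right matrix_mul_assoc
        del: sum.lessThan_Suc)
qed

lemma has_derivative_mat_pow:
  "((\<lambda>X. mat_pow X k) has_derivative mat_pow_deriv k X) (at X within S)"
proof (induction k)
  case 0
  show ?case by (simp add: mat_pow_deriv_def[abs_def])
next
  case (Suc k)
  from bounded_bilinear.FDERIV[OF bounded_bilinear_matrix_mult has_derivative_ident Suc]
  show ?case by (simp add: mat_pow_deriv_Suc[abs_def] add.commute)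
qed

text \<open>Termwise differentiation is justified on a ball around 0 that contains \<open>A\<close>,
  where the differentiated series has a summable majorant independent of the point.\<close>

lemma has_derivative_mat_exp_sums:
  fixes A :: "real^'n^'n"
  obtains D where "(mat_exp has_derivative D) (at A)"
    and "\<And>H. (\<lambda>k. (1 / fact k) *\<^sub>R mat_pow_deriv k A H) sums D H"
proof -
  obtain I K where K: "I \<ge> 0" "K > 0"
      "\<And>(X :: real^'n^'n) (Y :: real^'n^'n). norm (X ** Y) \<le> norm X * norm Y * K"
    and pow_bound: "\<And>(X :: real^'n^'n) k. norm (mat_pow X k) \<le> I * (norm X * K) ^ k"
    by (rule mat_pow_norm_bound) (rule that)
  define R where "R = norm A + 1"
  define S where "S = ball (0 :: real^'n^'n) R"
  define q where "q = R * K"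
  have "R > 0" by (simp add: R_def add_nonneg_pos)
  then have q: "q > 0" using K by (simp add: q_def)
  have pow: "norm (mat_pow X k) \<le> I * q ^ k" if "X \<in> S" for X k
    using that K unfolding q_def S_def
    by (intro order_trans[OF pow_bound] mult_left_mono power_mono mult_right_mono) auto
  \<comment> \<open>The derivative of the \<open>k\<close>-th power has \<open>k\<close> summands,
    each at most \<open>I\<^sup>2 * K\<^sup>2 * q ^ (k - 1) * norm H\<close>; the count
    \<open>k\<close> turns \<open>1 / fact k\<close> into \<open>1 / fact (k - 1)\<close>. The value
    \<open>M 0\<close> only has to be nonnegative.\<close>
  define M where "M k = (I\<^sup>2 * K\<^sup>2) * (inverse (fact (k - 1)) * q ^ (k - 1))" for k
  have M: "summable M"
    using summable_exp[of q] 
    by (subst summable_Suc_iff[symmetric]) (simp add: M_def summable_mult)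
  define f where "f k X = (1 / fact k) *\<^sub>R mat_pow X k" for k and X :: "real^'n^'n"
  define f' where "f' k X H = (1 / fact k) *\<^sub>R mat_pow_deriv k X H" for k and X H :: "real^'n^'n"
  define g' where "g' X H = (\<Sum>k. f' k X H)" for X H :: "real^'n^'n"
  have f'_bound: "norm (f' k X H) \<le> M k * norm H" if X: "X \<in> S" for k X H
  proof (cases k)
    case 0
    then show ?thesis by (simp add: f'_def mat_pow_deriv_def M_def q)
  next
    case (Suc l)
    have summand: "norm (mat_pow X a ** H ** mat_pow X (l - a)) \<le> I\<^sup>2 * K\<^sup>2 * q ^ l * norm H"
      if "a \<le> l" for a
    proof -
      have "norm (mat_pow X a ** H ** mat_pow X (l - a))
          \<le> norm (mat_pow X a ** H) * norm (mat_pow X (l - a)) * K" by (rule K(3))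
      also have "\<dots> \<le> (norm (mat_pow X a) * norm H * K) * norm (mat_pow X (l - a)) * K"
        using K(2,3) by (intro mult_right_mono) auto
      also have "\<dots> \<le> (I * q ^ a * norm H * K) * (I * q ^ (l - a)) * K"
        using K q pow[OF X]
        by (intro mult_mono order_refl mult_nonneg_nonneg) auto
      also have "\<dots> = I\<^sup>2 * K\<^sup>2 * (q ^ a * q ^ (l - a)) * norm H"
        by (simp add: power2_eq_square mult_ac)
      finally show ?thesis using that by (simp add: power_add[symmetric])
    qed
    have "norm (mat_pow_deriv k X H) \<le> (\<Sum>a<k. I\<^sup>2 * K\<^sup>2 * q ^ l * norm H)"
      unfolding mat_pow_deriv_def using summand Suc by (intro sum_norm_le) auto
    also have "\<dots> = real (Suc l) * (I\<^sup>2 * K\<^sup>2 * q ^ l * norm H)"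
      using Suc by simp
    finally have "norm (f' k X H) \<le> 1 / fact k * (real (Suc l) * (I\<^sup>2 * K\<^sup>2 * q ^ l * norm H))"
      by (simp add: f'_def divide_right_mono)
    also have "\<dots> = M k * norm H"
      by (simp add: M_def Suc fact_Suc field_simps del: of_nat_Suc)
    finally show ?thesis .
  qed
  have f'_summable: "summable (\<lambda>k. f' k X H)" if "X \<in> S" for X H
    by (rule summable_comparison_test[where g = "\<lambda>k. M k * norm H"])
       (use f'_bound[OF that] M in \<open>auto intro: summable_mult2\<close>)
  have M_tail: "(\<lambda>n. \<Sum>k. M (k + n)) \<longlonglongrightarrow> 0"
    by (rule suminf_exist_split2[OF M])
  have "\<exists>g. \<forall>X\<in>S. (\<lambda>k. f k X) sums g X \<and> (g has_derivative g' X) (at X within S)"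
  proof (rule has_derivative_series)
    show "convex S" by (simp add: S_def)
    show "(f k has_derivative f' k X) (at X within S)" for k X
      unfolding f_def[abs_def] f'_def[abs_def]
      by (rule has_derivative_scaleR_right has_derivative_mat_pow)+
    show "(0 :: real^'n^'n) \<in> S" using \<open>R > 0\<close> by (simp add: S_def)
    show "(\<lambda>k. f k 0) sums mat_exp 0" unfolding f_def by (rule mat_exp_sums)
    \<comment> \<open>Uniformly on \<open>S\<close>, cutting off the derivative series at
      \<open>n\<close> costs at most the tail of \<open>M\<close> times
      \<open>norm H\<close>.\<close>
    fix e :: real assume "e > 0"
    from order_tendstoD(2)[OF M_tail this]
    show "\<forall>\<^sub>F n in sequentially. \<forall>X\<in>S. \<forall>H. norm ((\<Sum>k<n. f' k X H) - g' X H) \<le> e * norm H"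
    proof eventually_elim
      case (elim n)
      show ?case
      proof (intro ballI allI)
        fix X H assume X: "X \<in> S"
        have "(\<Sum>k. f' (k + n) X H) = g' X H - (\<Sum>k<n. f' k X H)"
          unfolding g'_def by (rule suminf_minus_initial_segment[OF f'_summable[OF X]])
        then have "norm ((\<Sum>k<n. f' k X H) - g' X H) = norm (\<Sum>k. f' (k + n) X H)"
          by (simp add: norm_minus_commute)
        also have "\<dots> \<le> (\<Sum>k. M (k + n) * norm H)"
          using M by (intro norm_suminf_le f'_bound X summable_mult2)
            (simp add: summable_iff_shift)
        also have "\<dots> = (\<Sum>k. M (k + n)) * norm H"
          using M by (intro suminf_mult2[symmetric]) (simp add: summable_iff_shift)
        also have "\<dots> \<le> e * norm H"
          using elim by (intro mult_right_mono) auto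
        finally show "norm ((\<Sum>k<n. f' k X H) - g' X H) \<le> e * norm H" .
      qed
    qed
  qed
  then obtain g where g: "\<And>X. X \<in> S \<Longrightarrow> (\<lambda>k. f k X) sums g X"
      "\<And>X. X \<in> S \<Longrightarrow> (g has_derivative g' X) (at X within S)" by blast
  \<comment> \<open>Openness turns the derivative within \<open>S\<close> into a derivative at
    \<open>A\<close>.\<close>
  have "A \<in> S" "open S" by (simp_all add: S_def R_def)
  have "mat_exp X = g X" if "X \<in> S" for X
    using g(1)[OF that] by (simp add: mat_exp_def f_def sums_iff)
  then have "(mat_exp has_derivative g' A) (at A)"
    using has_derivative_transform_within_open[OF _ \<open>open S\<close> \<open>A \<in> S\<close>]
      g(2)[OF \<open>A \<in> S\<close>] at_within_open[OF \<open>A \<in> S\<close> \<open>open S\<close>] by metis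
  moreover have "(\<lambda>k. (1 / fact k) *\<^sub>R mat_pow_deriv k A H) sums g' A H" for H
    using summable_sums[OF f'_summable[OF \<open>A \<in> S\<close>, of H]] by (simp add: g'_def f'_def)
  ultimately show thesis by (rule that)
qed

text \<open>The binomial theorem applies because a multiple of the identity commutes with
  \<open>X\<close>.\<close>

lemma mat_pow_shift:
  fixes X :: "real^'n^'n"
  shows "mat_pow (X + c *\<^sub>R mat 1) k = (\<Sum>a\<le>k. (of_nat (k choose a) * c ^ (k - a)) *\<^sub>R mat_pow X a)"
proof (induction k)
  case 0
  show ?case by simp
next
  case (Suc k)
  interpret bounded_bilinear "(**) :: real^'n^'n \<Rightarrow> real^'n^'n \<Rightarrow> real^'n^'n"
    by (rule bounded_bilinear_matrix_mult)
  define t where "t l a = (of_nat (k choose a) * c ^ l) *\<^sub>R mat_pow X (a::nat)" for l a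
  define u where "u a = (of_nat (Suc k choose a) * c ^ (Suc k - a)) *\<^sub>R mat_pow X a" for a
  let ?S = "\<Sum>a\<le>k. (of_nat (k choose a) * c ^ (k - a)) *\<^sub>R mat_pow X a"
  have "mat_pow (X + c *\<^sub>R mat 1) (Suc k) = X ** ?S + c *\<^sub>R ?S"
    by (simp add: Suc add_left scaleR_left)
  also have "X ** ?S = (\<Sum>a\<le>k. (of_nat (k choose a) * c ^ (k - a)) *\<^sub>R mat_pow X (Suc a))"
    by (simp add: sum_right scaleR_right)
  also have "c *\<^sub>R ?S = (\<Sum>a\<le>k. t (Suc k - a) a)"
    unfolding scaleR_sum_right t_def
    by (intro sum.cong) (auto simp: Suc_diff_le mult_ac)
  \<comment> \<open>The added term is zero because \<open>k choose Suc k\<close> is. After splitting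
    off index 0, both sums run over the powers \<open>Suc a\<close>, ready for Pascal's
    rule.\<close>
  also have "\<dots> = (\<Sum>a\<le>Suc k. t (Suc k - a) a)"
    by (simp add: t_def binomial_eq_0)
  also have "\<dots> = t (Suc k) 0 + (\<Sum>a\<le>k. t (k - a) (Suc a))"
    by (subst sum.atMost_Suc_shift) simp
  also have "(\<Sum>a\<le>k. (of_nat (k choose a) * c ^ (k - a)) *\<^sub>R mat_pow X (Suc a))
      + (t (Suc k) 0 + (\<Sum>a\<le>k. t (k - a) (Suc a))) = u 0 + (\<Sum>a\<le>k. u (Suc a))"
    by (simp add: u_def t_def algebra_simps sum.distrib[symmetric] del: mat_pow.simps)
  also have "\<dots> = (\<Sum>a\<le>Suc k. u a)"
    by (subst sum.atMost_Suc_shift) simp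
  finally show ?case by (simp add: u_def)
qed

text \<open>Entry by entry, the binomial expansion makes the series of the shifted matrix the Cauchy
  product of the series of \<open>mat_exp X\<close> and \<open>exp c\<close>.\<close>

lemma mat_exp_shift:
  fixes X :: "real^'n^'n"
  shows "mat_exp (X + c *\<^sub>R mat 1) = exp c *\<^sub>R mat_exp X"
proof -
  have entry_sums: "(\<lambda>k. ((1 / fact k) *\<^sub>R mat_pow Y k) $ u $ v) sums (mat_exp Y $ u $ v)"
    for Y :: "real^'n^'n" and u v
    by (intro bounded_linear.sums[OF bounded_linear_vec_nth] mat_exp_sums)
  have "mat_exp (X + c *\<^sub>R mat 1) $ u $ v = mat_exp X $ u $ v * exp c" for u v
  proof -
    define a where "a k = ((1 / fact k) *\<^sub>R mat_pow X k) $ u $ v" for k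
    define b where "b k = c ^ k /\<^sub>R fact k" for k
    have entry: "norm (Y $ u $ v) \<le> norm Y" for Y :: "real^'n^'n"
      using Finite_Cartesian_Product.norm_nth_le[of "Y $ u" v]
        Finite_Cartesian_Product.norm_nth_le[of Y u] by linarith
    have "summable (\<lambda>k. norm (a k))"
      unfolding a_def
      by (rule summable_norm_comparison_test[OF _ summable_norm_mat_exp[of X]])
         (intro exI allI impI entry)
    moreover have "summable (\<lambda>k. norm (b k))"
      unfolding b_def by (rule summable_norm_exp)
    ultimately have "(\<lambda>k. \<Sum>i\<le>k. a i * b (k - i)) sums (suminf a * suminf b)"
      by (rule Cauchy_product_sums)
    moreover have "(\<Sum>i\<le>k. a i * b (k - i)) = ((1 / fact k) *\<^sub>R mat_pow (X + c *\<^sub>R mat 1) k) $ u $ v" for k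
      unfolding mat_pow_shift
      by (auto simp: a_def b_def sum_distrib_left binomial_fact intro!: sum.cong) (simp add: field_simps)
    ultimately have "(\<lambda>k. ((1 / fact k) *\<^sub>R mat_pow (X + c *\<^sub>R mat 1) k) $ u $ v) sums (suminf a * suminf b)"
      by simp
    moreover have "suminf a = mat_exp X $ u $ v" "suminf b = exp c"
      using entry_sums[of X u v] exp_converges[of c] by (simp_all add: a_def[abs_def] b_def[abs_def] sums_iff)
    ultimately show ?thesis
      using sums_unique2[OF entry_sums] by metis
  qed
  then show ?thesis
    by (simp add: vec_eq_iff mult.commute)
qed

text \<open>Writing \<open>mat_exp X\<close> as
  \<open>exp c *\<^sub>R mat_exp (X - c *\<^sub>R mat 1)\<close> moves the expansion to the shifted
  matrix, whose numerical radius is the quantity under control.\<close>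

lemma L_exp_sums:
  fixes A :: "real^'n^'n"
  shows "(\<lambda>k. exp c * (mat_pow_deriv k (A - c *\<^sub>R mat 1) H $ u $ v / fact k)) sums (L_exp A H $ u $ v)"
proof -
  let ?B = "A - c *\<^sub>R mat 1"
  obtain D where D: "(mat_exp has_derivative D) (at ?B)"
    "\<And>H. (\<lambda>k. (1 / fact k) *\<^sub>R mat_pow_deriv k ?B H) sums D H"
    by (rule has_derivative_mat_exp_sums) (rule that)
  have "((\<lambda>X. X - c *\<^sub>R mat 1) has_derivative (\<lambda>H. H)) (at A)"
    by (auto intro!: derivative_eq_intros)
  from has_derivative_compose[OF this D(1)]
  have "((\<lambda>X. exp c *\<^sub>R mat_exp (X - c *\<^sub>R mat 1)) has_derivative (\<lambda>H. exp c *\<^sub>R D H)) (at A)"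
    by (rule has_derivative_scaleR_right)
  then have "(mat_exp has_derivative (\<lambda>H. exp c *\<^sub>R D H)) (at A)"
    by (simp add: mat_exp_shift[symmetric])
  then have "L_exp A H = exp c *\<^sub>R D H"
    unfolding L_exp_def by (simp add: frechet_derivative_at[symmetric])
  moreover have "(\<lambda>k. exp c * (((1 / fact k) *\<^sub>R mat_pow_deriv k ?B H) $ u $ v)) sums (exp c * (D H $ u $ v))"
    by (intro sums_mult bounded_linear.sums[OF bounded_linear_vec_nth] D(2))
  ultimately show ?thesis by simp
qed

lemma unit_matrix_sandwich:
  fixes X Y :: "real^'n^'n"
  shows "(X ** unit_matrix i j ** Y) $ u $ v = X $ u $ i * Y $ j $ v"
proof -
  have "unit_matrix i j $ k $ l = (if k = i then if l = j then 1 else 0 else 0)" for k l :: 'n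
    by (simp add: unit_matrix_def matrix_matrix_mult_def columnvector_def rowvector_def axis_def)
  then show ?thesis
    by (simp add: matrix_matrix_mult_def if_distrib[of "\<lambda>x. x * _"] if_distrib[of "\<lambda>x. _ * x"] cong: if_cong)
qed

section \<open>Distances and powers of the adjacency matrix\<close>

text \<open>Paths must not repeat nodes. If \<open>x\<close> already lies on \<open>p\<close>, the
  part of \<open>p\<close> from \<open>x\<close> on is used instead, which is no longer than
  \<open>p\<close>.\<close>

lemma path_extend_front:
  assumes "is_path G z p y" "(x, z) \<in> edges G"
  obtains q where "is_path G x q y" "length q \<le> length p + 1"
proof (cases "x \<in> set p")
  case True
  then obtain p1 p2 where p: "p = p1 @ x # p2" by (meson split_list)
  with assms have "is_path G x (x # p2) y"
    by (auto simp: is_path_def successively_append_iff)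
  then show thesis using p by (intro that[of "x # p2"]) auto
next
  case False
  with assms have "is_path G x (x # p) y"
    by (cases p) (auto simp: is_path_def)
  then show thesis by (intro that[of "x # p"]) auto
qed

text \<open>The diagonal shift only adds the option of staying at a node, so \<open>k\<close>
  factors traverse at most \<open>k\<close> edges. Since \<open>p\<close> lists nodes, the bound is
  \<open>k + 1\<close>.\<close>

lemma mat_pow_shifted_adjacency_nonzero_imp_path:
  assumes "mat_pow (adjacency G - c *\<^sub>R mat 1) k $ x $ y \<noteq> 0"
  shows "\<exists>p. is_path G x p y \<and> length p \<le> k + 1"
  using assms
proof (induction k arbitrary: x)
  case 0
  then have "x = y" by (auto simp: mat_def split: if_splits)
  then have "is_path G x [x] y" by (simp add: is_path_def)
  then show ?case by (intro exI[of _ "[x]"]) simp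
next
  case (Suc k)
  let ?B = "adjacency G - c *\<^sub>R mat 1"
  have "(\<Sum>z\<in>UNIV. ?B $ x $ z * mat_pow ?B k $ z $ y) \<noteq> 0"
    using Suc.prems by (simp add: matrix_matrix_mult_def)
  then obtain z where z: "?B $ x $ z * mat_pow ?B k $ z $ y \<noteq> 0"
    by (meson sum.not_neutral_contains_not_neutral)
  with Suc.IH[of z] obtain p where p: "is_path G z p y" "length p \<le> k + 1" by auto
  from z have "x = z \<or> (x, z) \<in> edges G"
    by (auto simp: adjacency_def mat_def split: if_splits)
  then show ?case
  proof
    assume "x = z"
    with p show ?thesis by auto
  next
    assume "(x, z) \<in> edges G"
    with p(1) obtain q where "is_path G x q y" "length q \<le> length p + 1"
      by (rule path_extend_front)
    with p(2) show ?thesis by (intro exI[of _ q]) simp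
  qed
qed

text \<open>This includes infinite distance, where the entry vanishes for every power.\<close>

lemma mat_pow_shifted_adjacency_eq_0:
  assumes "enat k < geodesic_dist G x y"
  shows "mat_pow (adjacency G - c *\<^sub>R mat 1) k $ x $ y = 0"
proof (rule ccontr)
  assume "mat_pow (adjacency G - c *\<^sub>R mat 1) k $ x $ y \<noteq> 0"
  from mat_pow_shifted_adjacency_nonzero_imp_path[OF this]
  obtain p where p: "is_path G x p y" "length p \<le> k + 1" by blast
  then have "geodesic_dist G x y \<le> enat (length p - 1)"
    unfolding geodesic_dist_def by (intro INF_lower) simp
  also have "\<dots> \<le> enat k" using p by simp
  finally show False using assms by simp
qed

section \<open>The incomplete gamma function as an exponential tail\<close>

lemma lower_incomplete_gamma_nat:
  assumes "r \<ge> 0"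
  shows "lower_incomplete_gamma (real (Suc n)) r = fact n * (1 - exp (- r) * (\<Sum>l\<le>n. r ^ l / fact l))"
proof -
  define S where "S t = (\<Sum>l\<le>n. t ^ l / fact l)" for t :: real
  \<comment> \<open>An antiderivative of \<open>t ^ n * exp (- t)\<close>: differentiating
    \<open>S\<close> removes only its last term, so the product rule cancels everything
    else.\<close>
  define F where "F t = - (fact n * (exp (- t) * S t))" for t
  have deriv: "((\<lambda>t::real. \<Sum>l\<le>n. t ^ l / fact l) has_real_derivative
      (\<Sum>l\<le>n. t ^ l / fact l) - t ^ n / fact n) (at t)" for t
  proof (induction n)
    case 0
    show ?case by simp
  next
    case (Suc n)
    have "((\<lambda>t::real. t ^ Suc n / fact (Suc n)) has_real_derivative t ^ n / fact n) (at t)"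
      using DERIV_cdivide[OF DERIV_pow[of "Suc n" t], of "fact (Suc n)"]
      by (simp add: fact_Suc del: of_nat_Suc)
    from DERIV_add[OF Suc this] show ?case by simp
  qed
  have "(F has_real_derivative t ^ n * exp (- t)) (at t)" for t
  proof -
    have "((\<lambda>t. exp (- t)) has_real_derivative - exp (- t)) (at t)"
      by (auto intro!: derivative_eq_intros)
    from DERIV_minus[OF DERIV_cmult[where c = "fact n", OF DERIV_mult[OF this deriv[folded S_def]]]]
    show ?thesis by (simp add: F_def[abs_def] algebra_simps)
  qed
  then have "((\<lambda>t. t ^ n * exp (- t)) has_integral (F r - F 0)) {0..r}"
    by (intro fundamental_theorem_of_calculus assms)
       (auto simp: has_real_derivative_iff_has_vector_derivative[symmetric] has_field_derivative_at_within)
  moreover have "F r - F 0 = fact n * (1 - exp (- r) * (\<Sum>l\<le>n. r ^ l / fact l))"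
    by (simp add: F_def S_def sum.atMost_shift algebra_simps)
  ultimately have "((\<lambda>t. t ^ n * exp (- t)) has_integral
      fact n * (1 - exp (- r) * (\<Sum>l\<le>n. r ^ l / fact l))) {0..r}" by simp
  \<comment> \<open>The integrands may differ at 0: for \<open>n = 0\<close> the real power
    \<open>0 powr 0\<close> is 0 while \<open>0 ^ 0\<close> is 1. A single point does not affect the
    integral.\<close>
  then have "((\<lambda>t. t powr (real (Suc n) - 1) * exp (- t)) has_integral
      fact n * (1 - exp (- r) * (\<Sum>l\<le>n. r ^ l / fact l))) {0..r}"
    by (rule has_integral_spike[of "{0}", rotated 2]) (auto simp: powr_realpow)
  then show ?thesis
    unfolding lower_incomplete_gamma_def by (rule integral_unique)
qed

text \<open>Multiplied by \<open>exp r / fact (k - 1)\<close>, the closed form of the gamma integral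
  is \<open>exp r\<close> minus its first \<open>k\<close> Taylor terms.\<close>

lemma exp_tail_sums_lower_incomplete_gamma:
  fixes r :: real
  assumes "r \<ge> 0" "k \<ge> 1"
  shows "(\<lambda>l. r ^ (l + k) / fact (l + k)) sums (exp r * (lower_incomplete_gamma (real k) r / fact (k - 1)))"
proof -
  obtain n where k: "k = Suc n" using assms(2) by (cases k) auto
  have "(\<lambda>l. r ^ l / fact l) sums exp r"
    using exp_converges[of r] by (simp add: divide_inverse mult.commute)
  from sums_split_initial_segment[OF this, of k]
  have "(\<lambda>l. r ^ (l + k) / fact (l + k)) sums (exp r - (\<Sum>l<k. r ^ l / fact l))" .
  also have "exp r - (\<Sum>l<k. r ^ l / fact l) = exp r * (1 - exp (- r) * (\<Sum>l\<le>n. r ^ l / fact l))"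
    by (simp add: k lessThan_Suc_atMost right_diff_distrib mult.assoc[symmetric] exp_minus_inverse)
  also have "\<dots> = exp r * (lower_incomplete_gamma (real k) r / fact (k - 1))"
    unfolding k lower_incomplete_gamma_nat[OF assms(1)] by simp
  finally show ?thesis .
qed

section \<open>The decay bound\<close>

lemma hinner_shift:
  fixes A :: "real^'n^'n"
  shows "hinner y (map_matrix complex_of_real (A - s *\<^sub>R mat 1) *v y)
    = hinner y (map_matrix complex_of_real A *v y) - of_real s * hinner y y"
proof -
  have "map_matrix complex_of_real (A - s *\<^sub>R mat 1) *v y
      = map_matrix complex_of_real A *v y - of_real s *s y"
  proof (rule vec_eq_iff[THEN iffD2], rule allI)
    fix k
    have "(map_matrix complex_of_real (A - s *\<^sub>R mat 1) *v y) $ k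
        = (\<Sum>l\<in>UNIV. of_real (A $ k $ l) * y $ l - (if l = k then of_real s * y $ l else 0))"
      unfolding matrix_vector_mult_def by (auto simp: mat_def left_diff_distrib intro!: sum.cong)
    also have "\<dots> = (map_matrix complex_of_real A *v y - of_real s *s y) $ k"
      by (simp add: sum_subtractf matrix_vector_mult_def)
    finally show "(map_matrix complex_of_real (A - s *\<^sub>R mat 1) *v y) $ k
        = (map_matrix complex_of_real A *v y - of_real s *s y) $ k" .
  qed
  then show ?thesis
    by (simp add: hinner_diff_right hinner_scale_right)
qed

text \<open>The numerical range of a real matrix is symmetric about the real axis, so it lies in the
  disks about \<open>c\<close> and \<open>cnj c\<close>, and hence in the disk about the midpoint \<open>Re c\<close> of the centres.\<close>

lemma numerical_radius_real_shift:
  fixes A :: "real^'n^'n"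
  assumes W: "numerical_range (map_matrix complex_of_real A) \<subseteq> cball c r"
  shows "cmod (hinner y (map_matrix complex_of_real (A - Re c *\<^sub>R mat 1) *v y)) \<le> r * (norm y)\<^sup>2"
proof (cases "y = 0")
  case True
  then show ?thesis by (simp add: hinner_def)
next
  case False
  let ?M = "map_matrix complex_of_real A"
  have in_W: "dist c (hinner x (?M *v x)) \<le> r" if "norm x = 1" for x
    using W that unfolding numerical_range_def hinner_def by (auto simp: subset_iff)
  define x where "x = complex_of_real (1 / norm y) *s y"
  \<comment> \<open>Because \<open>A\<close> is real, the conjugate vector yields the conjugate
    value \<open>cnj z\<close>; this is the symmetry of the numerical range.\<close>
  define x' where "x' = (\<chi> k. cnj (x $ k))"
  have "hinner x x = 1"
    using False unfolding x_def hinner_scale_left hinner_scale_right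
    by (simp add: hinner_self power2_eq_square)
  then have "complex_of_real ((norm x)\<^sup>2) = complex_of_real 1"
    by (simp only: hinner_self of_real_1)
  then have "(norm x)\<^sup>2 = 1"
    by (simp only: of_real_eq_iff)
  then have norm_x: "norm x = 1"
    using power2_eq_imp_eq[of "norm x" 1] by simp
  moreover have "norm x' = norm x"
    by (simp add: x'_def norm_vec_def)
  ultimately have norm_x': "norm x' = 1" by simp
  define z where "z = hinner x (?M *v x)"
  have "hinner x' (?M *v x') = cnj z"
    by (simp add: z_def hinner_def x'_def matrix_vector_mult_def)
  with in_W[OF norm_x'] have "cmod (cnj z - c) \<le> r"
    by (simp add: dist_norm norm_minus_commute)
  then have 1: "cmod (z - cnj c) \<le> r"
    by (metis complex_cnj_cnj complex_cnj_diff complex_mod_cnj)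
  from in_W[OF norm_x] have 2: "cmod (z - c) \<le> r"
    by (simp add: z_def dist_norm norm_minus_commute)
  have mid: "2 * (z - of_real (Re c)) = (z - c) + (z - cnj c)"
    by (simp add: complex_eq_iff)
  have "cmod (2 * (z - of_real (Re c))) \<le> r + r"
    unfolding mid using 2 1 by (rule norm_triangle_mono)
  then have z: "cmod (z - of_real (Re c)) \<le> r"
    unfolding norm_mult by simp
  let ?N = "map_matrix complex_of_real (A - Re c *\<^sub>R mat 1)"
  have "y = complex_of_real (norm y) *s x"
    using False by (simp add: x_def vec_eq_iff)
  then have "hinner y (?N *v y)
      = hinner (complex_of_real (norm y) *s x) (?N *v (complex_of_real (norm y) *s x))"
    by simp
  also have "\<dots> = of_real ((norm y)\<^sup>2) * hinner x (?N *v x)"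
    by (simp add: matrix_vector_mult_scale hinner_scale_left hinner_scale_right power2_eq_square)
  also have "hinner x (?N *v x) = z - of_real (Re c)"
    using \<open>hinner x x = 1\<close> by (simp add: hinner_shift z_def)
  finally have "cmod (hinner y (?N *v y)) = cmod (z - of_real (Re c)) * (norm y)\<^sup>2"
    by (simp add: norm_mult norm_power)
  also have "\<dots> \<le> r * (norm y)\<^sup>2"
    by (rule mult_right_mono[OF z]) simp
  finally show ?thesis .
qed

section \<open>Vanishing and size of the differentiated powers\<close>

lemma mat_pow_deriv_unit_matrix:
  "mat_pow_deriv (Suc l) B (unit_matrix i j) $ u $ v
    = (\<Sum>a\<le>l. mat_pow B a $ u $ i * mat_pow B (l - a) $ j $ v)"
  by (simp add: mat_pow_deriv_def unit_matrix_sandwich lessThan_Suc_atMost)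

text \<open>The two exponents in each product add up to \<open>l\<close>, so at least one of them is
  smaller than the corresponding distance.\<close>

lemma mat_pow_deriv_shifted_adjacency_eq_0:
  assumes "enat l < geodesic_dist G u i + geodesic_dist G j v"
  shows "mat_pow_deriv (Suc l) (adjacency G - s *\<^sub>R mat 1) (unit_matrix i j) $ u $ v = 0"
  unfolding mat_pow_deriv_unit_matrix
proof (intro sum.neutral ballI)
  fix a assume "a \<in> {..l}"
  then have "enat l = enat a + enat (l - a)" by simp
  with assms have "enat a < geodesic_dist G u i \<or> enat (l - a) < geodesic_dist G j v"
    by (metis add_mono leD not_le)
  then show "mat_pow (adjacency G - s *\<^sub>R mat 1) a $ u $ i
      * mat_pow (adjacency G - s *\<^sub>R mat 1) (l - a) $ j $ v = 0"
    by (auto simp: mat_pow_shifted_adjacency_eq_0)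
qed

text \<open>Each of the \<open>Suc l\<close> products is at most \<open>2 * 2 * r ^ l\<close>, and
  their number cancels against the leading factor of \<open>fact (Suc l)\<close>.\<close>

lemma mat_pow_deriv_unit_matrix_bound:
  assumes "\<And>k u v. \<bar>mat_pow B k $ u $ v\<bar> \<le> 2 * r ^ k" "r \<ge> 0"
  shows "\<bar>mat_pow_deriv (Suc l) B (unit_matrix i j) $ u $ v\<bar> / fact (Suc l) \<le> 4 * (r ^ l / fact l)"
proof -
  have "\<bar>mat_pow_deriv (Suc l) B (unit_matrix i j) $ u $ v\<bar> \<le> (\<Sum>a\<le>l. 4 * r ^ l)"
    unfolding mat_pow_deriv_unit_matrix
  proof (intro order_trans[OF sum_abs] sum_mono)
    fix a assume a: "a \<in> {..l}"
    have "\<bar>mat_pow B a $ u $ i * mat_pow B (l - a) $ j $ v\<bar> \<le> (2 * r ^ a) * (2 * r ^ (l - a))"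
      unfolding abs_mult using assms by (intro mult_mono) auto
    also have "\<dots> = 4 * (r ^ a * r ^ (l - a))" by simp
    also have "r ^ a * r ^ (l - a) = r ^ l" using a by (simp flip: power_add)
    finally show "\<bar>mat_pow B a $ u $ i * mat_pow B (l - a) $ j $ v\<bar> \<le> 4 * r ^ l" .
  qed
  also have "\<dots> = real (Suc l) * (4 * r ^ l)" by simp
  finally have "\<bar>mat_pow_deriv (Suc l) B (unit_matrix i j) $ u $ v\<bar> / fact (Suc l)
      \<le> real (Suc l) * (4 * r ^ l) / fact (Suc l)"
    by (rule divide_right_mono) simp
  also have "\<dots> = 4 * (r ^ l / fact l)"
    by (simp add: fact_Suc del: of_nat_Suc)
  finally show ?thesis .
qed

theorem corollary5p9:
  fixes G :: "('n::finite) wdigraph" and c :: complex and r :: real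
    and i j u v :: 'n and m :: "'n \<Rightarrow> 'n \<Rightarrow> enat"
  assumes "is_digraph G"
    and "numerical_range (map_matrix complex_of_real (adjacency G)) \<subseteq> cball c r"
    and "\<And>x y. m x y = geodesic_dist G x i + geodesic_dist G j y"
  shows "(\<forall>k. m u v = enat k \<and> k \<ge> 1 \<longrightarrow>
            \<bar>L_exp (adjacency G) (unit_matrix i j) $ u $ v\<bar>
              \<le> 2 * (1 + sqrt 2)\<^sup>2 * exp (r + Re c)
                  * (lower_incomplete_gamma (real k) r / fact (k - 1)))
       \<and> (m u v = \<infinity> \<longrightarrow> L_exp (adjacency G) (unit_matrix i j) $ u $ v = 0)"
proof -
  let ?B = "adjacency G - Re c *\<^sub>R mat 1"
  define L where "L = L_exp (adjacency G) (unit_matrix i j) $ u $ v"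
  define t where "t k = exp (Re c) * (mat_pow_deriv k ?B (unit_matrix i j) $ u $ v / fact k)" for k
  have L: "t sums L"
    unfolding t_def[abs_def] L_def by (rule L_exp_sums)
  have radius: "cmod (hinner y (map_matrix complex_of_real ?B *v y)) \<le> r * (norm y)\<^sup>2" for y
    by (rule numerical_radius_real_shift[OF assms(2)])
  \<comment> \<open>At a unit vector the modulus of the quadratic form is at most
    \<open>r\<close>.\<close>
  have r: "r \<ge> 0"
    using order_trans[OF norm_ge_zero radius[of "axis u 1"]] by simp
  have t_bound: "\<bar>t (Suc l)\<bar> \<le> 4 * exp (Re c) * (r ^ l / fact l)" for l
    using mult_left_mono[OF mat_pow_deriv_unit_matrix_bound[OF mat_pow_entry_bound[OF r radius] r],
        of "exp (Re c)" l i j u v]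
    by (simp add: t_def abs_mult mult_ac del: fact_Suc)
  \<comment> \<open>Equality is allowed: term \<open>n\<close> has only \<open>n - 1\<close> factors
    besides the unit matrix. Hence the surviving terms start at \<open>Suc k\<close> and are matched
    with the exponential series of \<open>r\<close> from index \<open>k\<close>.\<close>
  have t_eq_0: "t n = 0" if "enat n \<le> m u v" for n
  proof (cases n)
    case 0
    then show ?thesis by (simp add: t_def mat_pow_deriv_def)
  next
    case (Suc l)
    with that have "enat l < m u v" by (metis Suc_ile_eq)
    then show ?thesis
      by (simp add: t_def Suc assms(3) mat_pow_deriv_shifted_adjacency_eq_0)
  qed
  have "\<bar>L\<bar> \<le> 2 * (1 + sqrt 2)\<^sup>2 * exp (r + Re c) * (lower_incomplete_gamma (real k) r / fact (k - 1))"
    if k: "m u v = enat k" "k \<ge> 1" for k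
  proof -
    let ?\<gamma> = "lower_incomplete_gamma (real k) r / fact (k - 1)"
    have tail: "(\<lambda>l. r ^ (l + k) / fact (l + k)) sums (exp r * ?\<gamma>)"
      by (rule exp_tail_sums_lower_incomplete_gamma[OF r k(2)])
    \<comment> \<open>The sign of the gamma quotient is read off from the series; it permits
      enlarging the constant 4 below.\<close>
    have "0 \<le> exp r * ?\<gamma>"
      using r by (intro sums_le[OF _ sums_zero tail]) auto
    then have \<gamma>: "0 \<le> ?\<gamma>" by (simp only: zero_le_mult_iff) auto
    have "(\<lambda>l. t (l + Suc k)) sums L"
      using L by (subst sums_zero_iff_shift) (auto simp: t_eq_0 k)
    moreover have majorant:
      "(\<lambda>l. 4 * exp (Re c) * (r ^ (l + k) / fact (l + k))) sums (4 * exp (Re c) * (exp r * ?\<gamma>))"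
      by (intro sums_mult tail)
    ultimately have "\<bar>L\<bar> \<le> 4 * exp (Re c) * (exp r * ?\<gamma>)"
      using norm_suminf_le[of "\<lambda>l. t (l + Suc k)", OF _ sums_summable[OF majorant]] t_bound
      by (simp add: sums_iff)
    also have "\<dots> = 4 * (exp (r + Re c) * ?\<gamma>)"
      by (simp add: exp_add mult_ac)
    also have "\<dots> \<le> 2 * (1 + sqrt 2)\<^sup>2 * (exp (r + Re c) * ?\<gamma>)"
    proof (rule mult_right_mono)
      \<comment> \<open>As \<open>sqrt 2\<close> is at least 1, the squared factor is already at
        least 4.\<close>
      have "(2 :: real)\<^sup>2 \<le> (1 + sqrt 2)\<^sup>2"
        by (intro power_mono) auto
      then show "4 \<le> 2 * (1 + sqrt 2)\<^sup>2" by simp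
      show "0 \<le> exp (r + Re c) * ?\<gamma>"
        using \<gamma> by (intro mult_nonneg_nonneg) auto
    qed
    finally show ?thesis by (simp only: mult.assoc)
  qed
  moreover have "L = 0" if "m u v = \<infinity>"
  proof -
    have "t = (\<lambda>_. 0)" using that by (auto simp: t_eq_0)
    with L show ?thesis by (metis sums_unique2 sums_zero)
  qed
  ultimately show ?thesis unfolding L_def by blast
qed

end
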